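(* Let $L$ be a completely distributive lattice that is a unital quantale with operation $*$, let $D,D'$ be domains, and let $\phi:D\to\underline{M}_{[L]}D'$ be a mapping. Then the strongest postcondition predicate transformer $\underline{sp}(\phi):\underline{M}_{[L]}D\to\underline{M}_{[L]}D'$ preserves (binary) joins, hence finite suprema. If $\phi$ is isotone, then $\underline{sp}(\phi)$ preserves all suprema if and only if $\phi$ is Scott continuous, i.e. preserves directed suprema.
   Context: A domain is a directed complete poset $D$ that is continuous: for each $b\in D$ the set $\{a\in D\mid a\ll b\}$ is directed with supremum $b$, where $a\ll b$ means that for each directed $C\subset D$ with $b\le \sup C$ there is $c\in C$ with $a\le c$. $L$ has bottom $0$ and top $1$. That $L$ is a unital quantale means: $*:L\times L\to L$ is an associative binary operation (not necessarily commutative), $1$ is a two-sided unit for $*$, and $*$ distributes over arbitrary suprema in each variable. $\underline{M}_{[L]}D=[D\to L^{op}]^{op}$ is the set of $L$-fuzzy monotonic predicates on $D$: all functions $m:D\to L$ such that $m:D\to L^{op}$ is Scott continuous, i.e. $m$ is antitone and $m(\sup C)=\inf\{m(c)\mid c\in C\}$ in $L$ for each directed $C\subset D$. It is ordered pointwise as functions to $L$ and is a complete lattice; infima and finite suprema are pointwise, while the supremum of an arbitrary family $\mathcal{F}$ is $b\mapsto \inf\{\sup_{f\in\mathcal{F}}f(a)\mid a\ll b\}$. For a mapping $\phi:D\to\underline{M}_{[L]}D'$ and $m\in\underline{M}_{[L]}D$, the strongest postcondition $\underline{sp}(\phi)(m)$ is the least $m'\in\underline{M}_{[L]}D'$ such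 that $m'(b)\ge m(a)*\phi(a)(b)$ for all $a\in D$, $b\in D'$; explicitly, $$\underline{sp}(\phi)(m)(b)=\inf\bigl\{\sup\{m(a)*\phi(a)(b')\mid a\in D\}\bigm| b'\in D',\ b'\ll b\bigr\},\quad b\in D'.$$ *)

theory Defs
  imports Main
begin

context ord
begin

definition directed :: "'a set \<Rightarrow> bool" where
  "directed C \<longleftrightarrow> C \<noteq> {} \<and> (\<forall>x\<in>C. \<forall>y\<in>C. \<exists>z\<in>C. x \<le> z \<and> y \<le> z)"

definition is_sup :: "'a set \<Rightarrow> 'a \<Rightarrow> bool" where
  "is_sup C s \<longleftrightarrow> (\<forall>x\<in>C. x \<le> s) \<and> (\<forall>u. (\<forall>x\<in>C. x \<le> u) \<longrightarrow> s \<le> u)"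

definition way_below :: "'a \<Rightarrow> 'a \<Rightarrow> bool"  (infix \<open>\<lless>\<close> 50) where
  "a \<lless> b \<longleftrightarrow> (\<forall>C s. directed C \<and> is_sup C s \<and> b \<le> s \<longrightarrow> (\<exists>c\<in>C. a \<le> c))"

end

class continuous_dcpo = order +
  assumes directed_has_sup: "directed C \<Longrightarrow> \<exists>s. is_sup C s"
    and directed_way_below: "directed {a. a \<lless> b}"
    and is_sup_way_below: "is_sup {a. a \<lless> b} b"

definition scott_continuous :: "('a::order \<Rightarrow> 'b::order) \<Rightarrow> bool" where
  "scott_continuous f \<longleftrightarrow> (\<forall>C s. directed C \<and> is_sup C s \<longrightarrow> is_sup (f ` C) (f s))"


text \<open>The unit is required to be the top element.\<close>

class unital_quantale = complete_lattice + monoid_mult +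
  assumes one_eq_top: "1 = top"
    and mult_Sup: "x * Sup A = (SUP a\<in>A. x * a)"
    and Sup_mult: "Sup A * x = (SUP a\<in>A. a * x)"


text \<open>Scott continuity into the order dual of \<open>'l\<close> is spelled out in terms of the order
  of \<open>'l\<close> itself; the order on predicates is the pointwise one inherited from \<open>'l\<close>.\<close>

typedef (overloaded) ('d::order, 'l::complete_lattice) fuzzy_pred =
  "{m :: 'd \<Rightarrow> 'l. antimono m \<and>
      (\<forall>C s. directed C \<and> is_sup C s \<longrightarrow> m s = (INF c\<in>C. m c))}"
  morphisms degree Fuzzy_pred
proof
  show "(\<lambda>_. top) \<in> {m :: 'd \<Rightarrow> 'l. antimono m \<and>
      (\<forall>C s. directed C \<and> is_sup C s \<longrightarrow> m s = (INF c\<in>C. m c))}"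
    by (auto simp: antimono_def)
qed

lemma antimono_degree: "a \<le> b \<Longrightarrow> degree m b \<le> degree m a"
  using degree[of m] by (auto simp: antimono_def)

lemma degree_directed_sup:
  "directed C \<Longrightarrow> is_sup C s \<Longrightarrow> degree m s = (INF c\<in>C. degree m c)"
  using degree[of m] by blast

lemma degree_Fuzzy_pred_INF:
  "degree (Fuzzy_pred (\<lambda>b. INF m\<in>F. degree m b)) = (\<lambda>b. INF m\<in>F. degree m b)"
proof (rule Fuzzy_pred_inverse, rule CollectI, intro conjI allI impI)
  show "antimono (\<lambda>b. INF m\<in>F. degree m b)"
    by (auto simp: antimono_def intro!: INF_mono antimono_degree)
next
  fix C and s :: 'a
  assume "directed C \<and> is_sup C s"
  then show "(INF m\<in>F. degree m s) = (INF c\<in>C. INF m\<in>F. degree m c)"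
    by (subst INF_commute) (auto intro!: INF_cong degree_directed_sup)
qed

text \<open>Infima are pointwise; suprema are the least upper bounds among all predicates.\<close>

instantiation fuzzy_pred :: (order, complete_lattice) complete_lattice
begin

definition "m \<le> n \<longleftrightarrow> (\<forall>b. degree m b \<le> degree n b)"

definition "m < n \<longleftrightarrow> m \<le> n \<and> \<not> n \<le> (m :: ('a, 'b) fuzzy_pred)"

definition "Inf F = Fuzzy_pred (\<lambda>b. INF m\<in>F. degree m b)"

definition "Sup F = Inf {u :: ('a, 'b) fuzzy_pred. \<forall>m\<in>F. m \<le> u}"

definition "inf m n = Inf {m, n :: ('a, 'b) fuzzy_pred}"

definition "sup m n = Sup {m, n :: ('a, 'b) fuzzy_pred}"

definition "bot = (Sup {} :: ('a, 'b) fuzzy_pred)"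

definition "top = (Inf {} :: ('a, 'b) fuzzy_pred)"

instance
proof -
  have ord: "m \<le> m" "m \<le> n \<Longrightarrow> n \<le> k \<Longrightarrow> m \<le> k" "m \<le> n \<Longrightarrow> n \<le> m \<Longrightarrow> m = n"
    for m n k :: "('a, 'b) fuzzy_pred"
    by (auto simp: less_eq_fuzzy_pred_def intro: order_trans)
      (meson antisym degree_inject ext)
  have low: "m \<in> F \<Longrightarrow> Inf F \<le> m" and gr: "(\<And>m. m \<in> F \<Longrightarrow> k \<le> m) \<Longrightarrow> k \<le> Inf F"
    for m k :: "('a, 'b) fuzzy_pred" and F
    by (auto simp: less_eq_fuzzy_pred_def Inf_fuzzy_pred_def degree_Fuzzy_pred_INF
        intro: INF_lower INF_greatest)
  have up: "m \<in> F \<Longrightarrow> m \<le> Sup F" and least: "(\<And>m. m \<in> F \<Longrightarrow> m \<le> k) \<Longrightarrow> Sup F \<le> k"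
    for m k :: "('a, 'b) fuzzy_pred" and F
    by (auto simp: Sup_fuzzy_pred_def intro: low gr)
  show "OFCLASS(('a, 'b) fuzzy_pred, complete_lattice_class)"
    by standard
      (auto simp: less_fuzzy_pred_def inf_fuzzy_pred_def sup_fuzzy_pred_def
        bot_fuzzy_pred_def top_fuzzy_pred_def intro: ord low gr up least)
qed

end

lemma degree_Inf: "degree (Inf F) b = (INF m\<in>F. degree m b)"
  by (simp add: Inf_fuzzy_pred_def degree_Fuzzy_pred_INF)


definition sp ::
  "('d::order \<Rightarrow> ('e::order, 'l::unital_quantale) fuzzy_pred)
    \<Rightarrow> ('d, 'l) fuzzy_pred \<Rightarrow> ('e, 'l) fuzzy_pred" where
  "sp \<phi> m = (LEAST m'. \<forall>a b. degree m a * degree (\<phi> a) b \<le> degree m' b)"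

lemma way_below_imp_le: "a \<lless> b \<Longrightarrow> a \<le> b" for a b :: "'a::continuous_dcpo"
  using is_sup_way_below[of b] by (auto simp: is_sup_def)

lemma le_way_below_trans: "a \<le> b \<Longrightarrow> b \<lless> c \<Longrightarrow> c \<le> d \<Longrightarrow> a \<lless> d"
  for a b c d :: "'a::order"
  unfolding way_below_def by (meson order_trans)

lemma way_below_interpolation:
  fixes a b :: "'a::continuous_dcpo"
  assumes "a \<lless> b"
  obtains c where "a \<lless> c" "c \<lless> b"
proof -
  let ?C = "{x. \<exists>y. x \<lless> y \<and> y \<lless> b}"
  have ne: "\<exists>x. x \<lless> y" for y :: 'a
    using directed_way_below[of y] by (auto simp: directed_def)
  have dir: "\<exists>z. z \<lless> y \<and> x1 \<le> z \<and> x2 \<le> z" if "x1 \<lless> y" "x2 \<lless> y" for x1 x2 y :: 'a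
    using directed_way_below[of y] that by (auto simp: directed_def)
  have "directed ?C"
    unfolding directed_def
  proof (intro conjI ballI)
    show "?C \<noteq> {}" using ne by blast
  next
    fix x1 x2 assume "x1 \<in> ?C" "x2 \<in> ?C"
    then obtain y1 y2 where "x1 \<lless> y1" "y1 \<lless> b" "x2 \<lless> y2" "y2 \<lless> b" by blast
    moreover from this obtain y where "y \<lless> b" "y1 \<le> y" "y2 \<le> y" using dir by blast
    ultimately have "x1 \<lless> y" "x2 \<lless> y" by (meson le_way_below_trans order_refl)+
    then show "\<exists>z\<in>?C. x1 \<le> z \<and> x2 \<le> z" using dir \<open>y \<lless> b\<close> by blast
  qed
  moreover have "is_sup ?C b"
    unfolding is_sup_def
  proof (intro conjI ballI allI impI)
    fix x assume "x \<in> ?C"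
    then show "x \<le> b" using way_below_imp_le order_trans by blast
  next
    fix u assume u: "\<forall>x\<in>?C. x \<le> u"
    have "y \<le> u" if "y \<lless> b" for y
      using u that is_sup_way_below[of y] unfolding is_sup_def by blast
    then show "b \<le> u" using is_sup_way_below[of b] by (auto simp: is_sup_def)
  qed
  ultimately obtain c where "c \<in> ?C" "a \<le> c"
    using assms unfolding way_below_def by blast
  then obtain y where "c \<lless> y" "y \<lless> b" by blast
  with \<open>a \<le> c\<close> have "a \<lless> y" by (meson le_way_below_trans order_refl)
  with \<open>y \<lless> b\<close> that show ?thesis by blast
qed

lemma way_below_directed_sup:
  fixes a s :: "'a::continuous_dcpo"
  assumes "a \<lless> s" "directed C" "is_sup C s"
  shows "\<exists>c\<in>C. a \<lless> c"
proof -
  obtain y where "a \<lless> y" "y \<lless> s" using way_below_interpolation[OF assms(1)] .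
  moreover obtain c where "c \<in> C" "y \<le> c"
    using \<open>y \<lless> s\<close> assms(2,3) unfolding way_below_def by blast
  ultimately show ?thesis by (meson le_way_below_trans order_refl)
qed

definition regularize :: "('d::continuous_dcpo \<Rightarrow> 'l::complete_lattice) \<Rightarrow> ('d, 'l) fuzzy_pred" where
  "regularize h = Fuzzy_pred (\<lambda>b. INF a\<in>{a. a \<lless> b}. h a)"

lemma degree_regularize: "degree (regularize h) b = (INF a\<in>{a. a \<lless> b}. h a)"
proof -
  let ?g = "\<lambda>b. INF a\<in>{a. a \<lless> b}. h a"
  have anti: "?g c \<le> ?g b" if "b \<le> c" for b c
    using that by (intro INF_superset_mono) (auto intro: le_way_below_trans)
  have "?g s = (INF c\<in>C. ?g c)" if C: "directed C" "is_sup C s" for C s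
  proof (rule antisym)
    show "?g s \<le> (INF c\<in>C. ?g c)"
      using C by (intro INF_greatest anti) (auto simp: is_sup_def)
    show "(INF c\<in>C. ?g c) \<le> ?g s"
    proof (rule INF_greatest)
      fix a assume "a \<in> {a. a \<lless> s}"
      then obtain c where "c \<in> C" "a \<lless> c" using way_below_directed_sup C by blast
      then show "(INF c\<in>C. ?g c) \<le> h a" by (meson INF_lower INF_lower2 mem_Collect_eq)
    qed
  qed
  then show ?thesis
    unfolding regularize_def using anti by (subst Fuzzy_pred_inverse) (auto simp: antimono_def)
qed

lemma degree_eq_INF_way_below: "degree m b = (INF a\<in>{a. a \<lless> b}. degree m a)"
  for b :: "'d::continuous_dcpo"
  by (rule degree_directed_sup[OF directed_way_below is_sup_way_below])

lemma regularize_le_iff: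
  assumes "antimono h"
  shows "regularize h \<le> m \<longleftrightarrow> (\<forall>b. h b \<le> degree m b)"
proof
  assume le: "regularize h \<le> m"
  show "\<forall>b. h b \<le> degree m b"
  proof
    fix b
    have "h b \<le> degree (regularize h) b"
      unfolding degree_regularize
      using assms by (intro INF_greatest) (auto simp: antimono_def way_below_imp_le)
    also have "\<dots> \<le> degree m b" using le by (simp add: less_eq_fuzzy_pred_def)
    finally show "h b \<le> degree m b" .
  qed
next
  assume "\<forall>b. h b \<le> degree m b"
  then show "regularize h \<le> m"
    unfolding less_eq_fuzzy_pred_def degree_regularize
    by (subst degree_eq_INF_way_below[of m]) (auto intro: INF_mono)
qed

lemma degree_Sup:
  "degree (Sup F) b = (INF a\<in>{a. a \<lless> b}. SUP m\<in>F. degree m a)"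
  for b :: "'d::continuous_dcpo"
proof -
  let ?h = "\<lambda>a. SUP m\<in>F. degree m a"
  have "antimono ?h" by (auto simp: antimono_def intro!: SUP_mono antimono_degree)
  then have "regularize ?h \<le> u \<longleftrightarrow> (\<forall>m\<in>F. m \<le> u)" for u
    by (subst regularize_le_iff) (auto simp: less_eq_fuzzy_pred_def SUP_le_iff)
  then have "regularize ?h = Sup F" by (meson Sup_least Sup_upper antisym order_refl)
  then show ?thesis using degree_regularize[of ?h b] by simp
qed

lemma degree_sp:
  fixes \<phi> :: "'d::order \<Rightarrow> ('e::continuous_dcpo, 'l::unital_quantale) fuzzy_pred"
  shows "degree (sp \<phi> m) b = (INF b'\<in>{b'. b' \<lless> b}. SUP a. degree m a * degree (\<phi> a) b')"
proof -
  let ?h = "\<lambda>b. SUP a. degree m a * degree (\<phi> a) b"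
  have mono: "x * y \<le> x * z" if "y \<le> z" for x y z :: 'l
    using mult_Sup[of x "{y, z}"] that by (simp add: sup.absorb2 le_iff_sup)
  have "antimono ?h"
    by (auto simp: antimono_def intro!: SUP_mono mono antimono_degree)
  then have *: "regularize ?h \<le> u \<longleftrightarrow> (\<forall>a b. degree m a * degree (\<phi> a) b \<le> degree u b)" for u
    by (subst regularize_le_iff) (auto simp: SUP_le_iff)
  have "sp \<phi> m = regularize ?h"
    unfolding sp_def by (rule Least_equality) (use * in auto)
  then show ?thesis using degree_regularize[of ?h b] by simp
qed

end

theory Submission
  imports Defs
begin

text \<open>
  The proof works with upper bounds: \<open>sp \<phi> m \<le> k\<close> holds exactly if
  \<open>degree m a * degree (\<phi> a) b \<le> degree k b\<close> for all \<open>a\<close> and \<open>b\<close>, so that no regularized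
  supremum has to be computed on the left-hand side.

  Binary joins of predicates are pointwise, since in \<open>'l\<close> binary joins distribute over arbitrary
  infima.  As \<open>*\<close> distributes over joins in its left argument, the upper bounds of
  \<open>sp \<phi> (sup m n)\<close> are the common upper bounds of \<open>sp \<phi> m\<close> and \<open>sp \<phi> n\<close>.

  An arbitrary join of predicates is pointwise only up to a step down along the way-below relation:
  \<open>degree (Sup F) a\<close> lies below the pointwise join at each \<open>a' \<lless> a\<close>.  If \<open>\<phi>\<close> is Scott continuous,
  then \<open>\<phi> a\<close> is the supremum of the \<open>\<phi> a'\<close> with \<open>a' \<lless> a\<close>, so the other factor can be moved from
  \<open>a\<close> to such points \<open>a'\<close> as well, and \<open>sp \<phi>\<close> preserves the join.

  Conversely, a monotone \<open>\<phi>\<close> is recovered from \<open>sp \<phi>\<close> by \<open>\<phi> a = sp \<phi> (down_pred a)\<close>, where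
  \<open>down_pred a\<close> is the crisp predicate of the principal ideal of \<open>a\<close>.  The map \<open>down_pred\<close> preserves
  directed suprema, hence so does \<open>\<phi>\<close> whenever \<open>sp \<phi>\<close> preserves suprema.
\<close>

section \<open>Multiplication in a unital quantale\<close>

lemma quantale_mult_mono:
  fixes x y u v :: "'l::unital_quantale"
  assumes "x \<le> y" "u \<le> v"
  shows "x * u \<le> y * v"
proof -
  have "x * u \<le> x * v"
    using mult_Sup[of x "{u, v}"] assms(2) by (simp add: sup.absorb2 le_iff_sup)
  also have "\<dots> \<le> y * v"
    using Sup_mult[of "{x, y}" v] assms(1) by (simp add: sup.absorb2 le_iff_sup)
  finally show ?thesis .
qed

lemma quantale_sup_mult: "sup x y * z = sup (x * z) (y * z)"
  for x y z :: "'l::unital_quantale"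
  using Sup_mult[of "{x, y}" z] by simp

lemma quantale_bot_mult: "bot * z = bot" for z :: "'l::unital_quantale"
  using Sup_mult[of "{}" z] by simp


section \<open>Joins of predicates\<close>

text \<open>
  The pointwise join of two predicates is again a predicate: by distributivity, the join of two
  infima over a directed set \<open>C\<close> is the infimum of the joins \<open>degree m c \<squnion> degree n c'\<close> over pairs,
  and antitonicity lets a common upper bound of \<open>c\<close> and \<open>c'\<close> in \<open>C\<close> replace both points.
\<close>

lemma degree_sup:
  fixes m n :: "('d::continuous_dcpo, 'l::complete_distrib_lattice) fuzzy_pred"
  shows "degree (sup m n) b = sup (degree m b) (degree n b)"
proof (rule antisym)
  let ?W = "{a. a \<lless> b}"
  have "degree (sup m n) b = (INF a\<in>?W. sup (degree m a) (degree n a))"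
    using degree_Sup[of "{m, n}" b] by simp
  also have "\<dots> \<le> (INF a\<in>?W. INF a'\<in>?W. sup (degree m a) (degree n a'))"
  proof (intro INF_greatest)
    fix a a' assume "a \<in> ?W" "a' \<in> ?W"
    then obtain c where c: "c \<in> ?W" "a \<le> c" "a' \<le> c"
      using directed_way_below[of b] unfolding directed_def by blast
    then show "(INF a\<in>?W. sup (degree m a) (degree n a)) \<le> sup (degree m a) (degree n a')"
      by (intro INF_lower2[OF c(1)] sup_mono antimono_degree)
  qed
  also have "\<dots> = (INF a\<in>?W. sup (degree m a) (degree n b))"
    by (simp add: degree_eq_INF_way_below[of n b] sup_INF)
  also have "\<dots> = sup (degree m b) (degree n b)"
    by (simp add: degree_eq_INF_way_below[of m b] INF_sup)
  finally show "degree (sup m n) b \<le> sup (degree m b) (degree n b)" .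
next
  have "m \<le> sup m n" "n \<le> sup m n" by simp_all
  then show "sup (degree m b) (degree n b) \<le> degree (sup m n) b"
    unfolding less_eq_fuzzy_pred_def by simp
qed

lemma degree_bot: "degree (bot :: ('d::continuous_dcpo, 'l::complete_lattice) fuzzy_pred) b = bot"
proof -
  have "{a. a \<lless> b} \<noteq> {}" using directed_way_below[of b] by (simp add: directed_def)
  then show ?thesis using degree_Sup[of "{} :: ('d, 'l) fuzzy_pred set" b] by simp
qed

lemma is_sup_Sup: "is_sup A (Sup A)" for A :: "'a::complete_lattice set"
  by (auto simp: is_sup_def intro: Sup_upper Sup_least)

lemma is_sup_imp_eq_Sup: "is_sup A s \<Longrightarrow> s = Sup A" for s :: "'a::complete_lattice"
  by (auto simp: is_sup_def intro!: antisym intro: Sup_upper Sup_least)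


section \<open>Upper bounds of strongest postconditions\<close>

lemma sp_le_iff:
  fixes \<phi> :: "'d::order \<Rightarrow> ('e::continuous_dcpo, 'l::unital_quantale) fuzzy_pred"
  shows "sp \<phi> m \<le> k \<longleftrightarrow> (\<forall>a b. degree m a * degree (\<phi> a) b \<le> degree k b)"
proof
  assume le: "sp \<phi> m \<le> k"
  show "\<forall>a b. degree m a * degree (\<phi> a) b \<le> degree k b"
  proof (intro allI)
    fix a b
    have "degree m a * degree (\<phi> a) b \<le> degree (sp \<phi> m) b"
      unfolding degree_sp
    proof (rule INF_greatest)
      fix b' assume "b' \<in> {b'. b' \<lless> b}"
      then have "degree m a * degree (\<phi> a) b \<le> degree m a * degree (\<phi> a) b'"
        by (intro quantale_mult_mono antimono_degree) (auto intro: way_below_imp_le)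
      also have "\<dots> \<le> (SUP a. degree m a * degree (\<phi> a) b')" by (rule SUP_upper) simp
      finally show "degree m a * degree (\<phi> a) b \<le> (SUP a. degree m a * degree (\<phi> a) b')" .
    qed
    also have "\<dots> \<le> degree k b" using le by (simp add: less_eq_fuzzy_pred_def)
    finally show "degree m a * degree (\<phi> a) b \<le> degree k b" .
  qed
next
  assume "\<forall>a b. degree m a * degree (\<phi> a) b \<le> degree k b"
  then show "sp \<phi> m \<le> k"
    unfolding less_eq_fuzzy_pred_def degree_sp
    by (subst degree_eq_INF_way_below[of k]) (auto intro!: INF_mono SUP_least)
qed

lemma mult_le_degree_sp: "degree m a * degree (\<phi> a) b \<le> degree (sp \<phi> m) b"
  for \<phi> :: "'d::order \<Rightarrow> ('e::continuous_dcpo, 'l::unital_quantale) fuzzy_pred"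
  using sp_le_iff[of \<phi> m "sp \<phi> m"] by simp

lemma mono_sp: "mono (sp \<phi>)"
  for \<phi> :: "'d::order \<Rightarrow> ('e::continuous_dcpo, 'l::unital_quantale) fuzzy_pred"
proof
  fix m n :: "('d, 'l) fuzzy_pred"
  assume "m \<le> n"
  then show "sp \<phi> m \<le> sp \<phi> n"
    unfolding sp_le_iff
    by (meson less_eq_fuzzy_pred_def mult_le_degree_sp order_refl order_trans quantale_mult_mono)
qed


section \<open>Finite suprema\<close>

lemma sp_sup:
  fixes \<phi> :: "'d::continuous_dcpo \<Rightarrow>
    ('e::continuous_dcpo, 'l::{complete_distrib_lattice, unital_quantale}) fuzzy_pred"
  shows "sp \<phi> (sup m n) = sup (sp \<phi> m) (sp \<phi> n)"
proof -
  have "sp \<phi> (sup m n) \<le> k \<longleftrightarrow> sup (sp \<phi> m) (sp \<phi> n) \<le> k" for k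
    by (auto simp: sp_le_iff degree_sup quantale_sup_mult)
  then show ?thesis by (meson antisym order_refl)
qed

lemma sp_bot: "sp \<phi> bot = bot"
  for \<phi> :: "'d::continuous_dcpo \<Rightarrow> ('e::continuous_dcpo, 'l::unital_quantale) fuzzy_pred"
  by (rule bot.extremum_uniqueI) (simp add: sp_le_iff degree_bot quantale_bot_mult)

lemma sp_Sup_finite:
  fixes \<phi> :: "'d::continuous_dcpo \<Rightarrow>
    ('e::continuous_dcpo, 'l::{complete_distrib_lattice, unital_quantale}) fuzzy_pred"
  assumes "finite F"
  shows "sp \<phi> (Sup F) = Sup (sp \<phi> ` F)"
  using assms by (induction F) (simp_all add: sp_bot sp_sup)


section \<open>Scott continuity implies preservation of suprema\<close>

text \<open>
  The degree of \<open>Sup F\<close> at \<open>a\<close> is an infimum over the points \<open>a' \<lless> a\<close>, whereas \<open>\<phi> a\<close> is a supremum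
  over the same points.  Multiplication distributes over the supremum, and for each \<open>a'\<close> the
  infimum may then be estimated by its member at \<open>a'\<close>.
\<close>

lemma sp_Sup_of_scott_continuous:
  fixes \<phi> :: "'d::continuous_dcpo \<Rightarrow> ('e::continuous_dcpo, 'l::unital_quantale) fuzzy_pred"
  assumes "scott_continuous \<phi>"
  shows "sp \<phi> (Sup F) = Sup (sp \<phi> ` F)"
proof (rule antisym)
  let ?k = "Sup (sp \<phi> ` F)"
  have "degree (Sup F) a * degree (\<phi> a) b \<le> degree ?k b" for a b
    unfolding degree_eq_INF_way_below[of ?k b]
  proof (rule INF_greatest)
    fix b' assume b': "b' \<in> {b'. b' \<lless> b}"
    let ?W = "{a'. a' \<lless> a}"
    have "\<phi> a = Sup (\<phi> ` ?W)"
      using assms directed_way_below[of a] is_sup_way_below[of a]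
      unfolding scott_continuous_def by (blast intro: is_sup_imp_eq_Sup)
    then have "degree (\<phi> a) b = (INF b'\<in>{b'. b' \<lless> b}. SUP a'\<in>?W. degree (\<phi> a') b')"
      by (simp add: degree_Sup image_image)
    also have "\<dots> \<le> (SUP a'\<in>?W. degree (\<phi> a') b')" using b' by (rule INF_lower)
    finally have "degree (Sup F) a * degree (\<phi> a) b
        \<le> degree (Sup F) a * (SUP a'\<in>?W. degree (\<phi> a') b')"
      by (intro quantale_mult_mono order_refl)
    also have "\<dots> = (SUP a'\<in>?W. degree (Sup F) a * degree (\<phi> a') b')"
      by (simp add: mult_Sup image_image)
    also have "\<dots> \<le> degree ?k b'"
    proof (rule SUP_least)
      fix a' assume a': "a' \<in> ?W"
      have "degree (Sup F) a \<le> (SUP f\<in>F. degree f a')"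
        unfolding degree_Sup using a' by (rule INF_lower)
      then have "degree (Sup F) a * degree (\<phi> a') b'
          \<le> (SUP f\<in>F. degree f a') * degree (\<phi> a') b'"
        by (intro quantale_mult_mono order_refl)
      also have "\<dots> = (SUP f\<in>F. degree f a' * degree (\<phi> a') b')"
        by (simp add: Sup_mult image_image)
      also have "\<dots> \<le> degree ?k b'"
      proof (rule SUP_least)
        fix f assume "f \<in> F"
        then have "sp \<phi> f \<le> ?k" by (intro Sup_upper imageI)
        then show "degree f a' * degree (\<phi> a') b' \<le> degree ?k b'" by (simp add: sp_le_iff)
      qed
      finally show "degree (Sup F) a * degree (\<phi> a') b' \<le> degree ?k b'" .
    qed
    finally show "degree (Sup F) a * degree (\<phi> a) b \<le> degree ?k b'" .
  qed
  then show "sp \<phi> (Sup F) \<le> ?k" by (simp add: sp_le_iff)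
next
  show "Sup (sp \<phi> ` F) \<le> sp \<phi> (Sup F)"
    by (intro SUP_least monoD[OF mono_sp] Sup_upper)
qed


section \<open>Preservation of suprema implies Scott continuity\<close>

definition down_pred :: "'d::order \<Rightarrow> ('d, 'l::complete_lattice) fuzzy_pred" where
  "down_pred a = Fuzzy_pred (\<lambda>x. if x \<le> a then top else bot)"

text \<open>The function is a predicate because a supremum lies below \<open>a\<close> only if all members do.\<close>

lemma degree_down_pred:
  "degree (down_pred a :: ('d::order, 'l::complete_lattice) fuzzy_pred) x
    = (if x \<le> a then top else bot)"
proof -
  let ?e = "\<lambda>x. if x \<le> a then top else (bot :: 'l)"
  have "?e s = (INF c\<in>C. ?e c)" if C: "directed C" "is_sup C s" for C s
  proof (cases "s \<le> a")
    case True
    then have "\<forall>c\<in>C. c \<le> a" using C(2) unfolding is_sup_def by (blast intro: order_trans)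
    with True show ?thesis by simp
  next
    case False
    then obtain c where "c \<in> C" "\<not> c \<le> a" using C(2) unfolding is_sup_def by blast
    then have "(INF c\<in>C. ?e c) \<le> bot" by (intro INF_lower2) auto
    with False show ?thesis by (simp add: bot_unique)
  qed
  moreover have "antimono ?e" by (auto simp: antimono_def dest: order_trans)
  ultimately show ?thesis
    unfolding down_pred_def by (subst Fuzzy_pred_inverse) auto
qed

lemma down_pred_le_iff: "down_pred a \<le> u \<longleftrightarrow> degree u a = top"
proof
  assume "down_pred a \<le> u"
  then have "degree (down_pred a) a \<le> degree u a" by (simp only: less_eq_fuzzy_pred_def)
  then show "degree u a = top" by (simp add: degree_down_pred top_unique)
next
  assume "degree u a = top"
  then have "degree u x = top" if "x \<le> a" for x
    using antimono_degree[OF that, of u] by (simp add: top_unique)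
  then show "down_pred a \<le> u" by (simp add: less_eq_fuzzy_pred_def degree_down_pred)
qed

text \<open>A predicate has degree \<open>top\<close> at a directed supremum exactly if it does at all members.\<close>

lemma down_pred_directed_sup:
  assumes "directed C" "is_sup C s"
  shows "down_pred s = Sup (down_pred ` C)"
proof -
  have "down_pred s \<le> u \<longleftrightarrow> Sup (down_pred ` C) \<le> u" for u
    by (simp add: SUP_le_iff down_pred_le_iff degree_directed_sup[OF assms] INF_top_conv)
  then show ?thesis by (meson antisym order_refl)
qed

text \<open>
  The unit of the multiplication is the degree \<open>top\<close>, so \<open>sp \<phi> (down_pred a)\<close> is the join of the
  \<open>\<phi> x\<close> with \<open>x \<le> a\<close>; by monotonicity \<open>\<phi> a\<close> is the largest of them.
\<close>

lemma sp_down_pred: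
  fixes \<phi> :: "'d::order \<Rightarrow> ('e::continuous_dcpo, 'l::unital_quantale) fuzzy_pred"
  assumes "mono \<phi>"
  shows "sp \<phi> (down_pred a) = \<phi> a"
proof -
  have deg: "degree (down_pred a) x * y = (if x \<le> a then y else bot)" for x and y :: 'l
    by (simp add: degree_down_pred quantale_bot_mult flip: one_eq_top)
  have "sp \<phi> (down_pred a) \<le> k \<longleftrightarrow> (\<forall>x\<le>a. \<phi> x \<le> k)" for k
    unfolding sp_le_iff deg by (auto simp: less_eq_fuzzy_pred_def)
  then have "sp \<phi> (down_pred a) \<le> k \<longleftrightarrow> \<phi> a \<le> k" for k
    using monoD[OF assms] by (meson order_refl order_trans)
  then show ?thesis by (meson antisym order_refl)
qed

lemma scott_continuous_of_sp_Sup: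
  fixes \<phi> :: "'d::order \<Rightarrow> ('e::continuous_dcpo, 'l::unital_quantale) fuzzy_pred"
  assumes "mono \<phi>" "\<And>F. sp \<phi> (Sup F) = Sup (sp \<phi> ` F)"
  shows "scott_continuous \<phi>"
  unfolding scott_continuous_def
proof (intro allI impI)
  fix C and s :: 'd
  assume "directed C \<and> is_sup C s"
  then have "down_pred s = Sup (down_pred ` C :: ('d, 'l) fuzzy_pred set)"
    by (blast intro: down_pred_directed_sup)
  then have "sp \<phi> (down_pred s) = Sup (sp \<phi> ` down_pred ` C)" by (simp only: assms(2))
  then have "\<phi> s = Sup (\<phi> ` C)" by (simp add: sp_down_pred[OF assms(1)] image_image)
  then show "is_sup (\<phi> ` C) (\<phi> s)" by (simp add: is_sup_Sup)
qed


section \<open>Preservation of suprema by strongest postconditions\<close>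

theorem proposition2p3:
  fixes \<phi> :: "'d::continuous_dcpo \<Rightarrow>
    ('e::continuous_dcpo, 'l::{complete_distrib_lattice, unital_quantale}) fuzzy_pred"
  shows "(\<forall>m n. sp \<phi> (sup m n) = sup (sp \<phi> m) (sp \<phi> n)) \<and>
    (\<forall>F. finite F \<longrightarrow> sp \<phi> (Sup F) = Sup (sp \<phi> ` F)) \<and>
    (mono \<phi> \<longrightarrow> ((\<forall>F. sp \<phi> (Sup F) = Sup (sp \<phi> ` F)) \<longleftrightarrow> scott_continuous \<phi>))"
  using sp_sup sp_Sup_finite sp_Sup_of_scott_continuous scott_continuous_of_sp_Sup by blast

end
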